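(* Let $(X_n)_{n\ge 0}$ be the elephant random walk with full (uniform) memory, with memory parameter $p\in[0,1]$ and first-step parameter $r\in[0,1]$. If $p>3/4$, then the walk $(X_n)_{n\ge0}$ is transient.
   Context: The elephant random walk (ERW) with full memory and parameters $p,r\in[0,1]$ is the process on $\mathbb{Z}$ defined by $X_0=0$ and $X_{n+1}=X_n+\eta_{n+1}$, where the steps $\eta_k\in\{-1,1\}$ are generated as follows. First, $\eta_1=1$ with probability $r$ and $\eta_1=-1$ with probability $1-r$. For $n\ge1$, given $\eta_1,\dots,\eta_n$, an index $n'$ is chosen uniformly at random from $\{1,\dots,n\}$, and then $\eta_{n+1}=\eta_{n'}$ with probability $p$ and $\eta_{n+1}=-\eta_{n'}$ with probability $1-p$. Equivalently, $\mathbb{P}[\eta_{n+1}=\eta\mid\eta_1,\dots,\eta_n]=\frac{1}{2n}\sum_{k=1}^n[1+(2p-1)\eta_k\eta]$ for $\eta=\pm1$, $n\ge1$. The walk is called transient if $|X_n|\to\infty$ almost surely as $n\to\infty$. *)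

theory Defs
  imports "HOL-Probability.Probability"
begin

text \<open>
  Law of the next step of the walk, given the history \<open>h 1, \<dots>, h n\<close> of the first \<open>n \<ge> 1\<close> steps.
\<close>

definition erw_next_step :: "real \<Rightarrow> nat \<Rightarrow> (nat \<Rightarrow> int) \<Rightarrow> int pmf" where
  "erw_next_step p n h =
     bind_pmf (pmf_of_set {1..n}) (\<lambda>k.
     bind_pmf (bernoulli_pmf p) (\<lambda>b.
     return_pmf (if b then h k else - h k)))"

text \<open>
  The closed form of the transition probabilities that is usually quoted for the walk.
\<close>

lemma pmf_erw_next_step:
  fixes h :: "nat \<Rightarrow> int"
  assumes p: "0 \<le> p" "p \<le> 1" and n: "1 \<le> n"
    and h: "\<And>k. k \<in> {1..n} \<Longrightarrow> h k \<in> {-1, 1}" and e: "e \<in> {-1, 1}"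
  shows "pmf (erw_next_step p n h) e =
           1 / (2 * real n) * (\<Sum>k=1..n. 1 + (2 * p - 1) * real_of_int (h k * e))"
proof -
  have "pmf (erw_next_step p n h) e =
      (\<Sum>k=1..n. p * indicator {e} (h k) + (1 - p) * indicator {e} (- h k)) / real n"
    using p n by (simp add: erw_next_step_def pmf_bind integral_pmf_of_set indicator_def mult.commute)
  also have "(\<Sum>k=1..n. p * indicator {e} (h k) + (1 - p) * indicator {e} (- h k)) =
      (\<Sum>k=1..n. (1 + (2 * p - 1) * real_of_int (h k * e)) / 2)"
  proof (rule sum.cong [OF refl])
    fix k assume "k \<in> {1..n}"
    then have "h k = 1 \<or> h k = -1" using h by blast
    moreover have "e = 1 \<or> e = -1" using e by blast
    ultimately show "p * indicator {e} (h k) + (1 - p) * indicator {e} (- h k) =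
        (1 + (2 * p - 1) * real_of_int (h k * e)) / 2"
      by (elim disjE) (simp_all add: indicator_def)
  qed
  finally show ?thesis
    by (simp add: sum_divide_distrib [symmetric])
qed

text \<open>
  Steps are indexed from 1; \<open>\<eta> 0\<close> plays no role.  The conditional law of \<open>\<eta> (n + 1)\<close> given
  \<open>\<eta> 1, \<dots>, \<eta> n\<close> is prescribed on each history \<open>h\<close> of positive probability; since the history takes
  only finitely many values, this is the full conditional distribution.
\<close>

locale elephant_random_walk = prob_space M
  for M :: "'a measure" and p r :: real
    and \<eta> :: "nat \<Rightarrow> 'a \<Rightarrow> int" and X :: "nat \<Rightarrow> 'a \<Rightarrow> int" +
  assumes step_measurable: "\<And>k. 1 \<le> k \<Longrightarrow> \<eta> k \<in> measurable M (count_space UNIV)"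
    and step_values: "\<And>k \<omega>. 1 \<le> k \<Longrightarrow> \<omega> \<in> space M \<Longrightarrow> \<eta> k \<omega> \<in> {-1, 1}"
    and first_step_pos: "\<P>(\<omega> in M. \<eta> 1 \<omega> = 1) = r"
    and first_step_neg: "\<P>(\<omega> in M. \<eta> 1 \<omega> = -1) = 1 - r"
    and next_step: "\<And>n h e. 1 \<le> n \<Longrightarrow> \<P>(\<omega> in M. \<forall>k\<in>{1..n}. \<eta> k \<omega> = h k) > 0 \<Longrightarrow>
        \<P>(\<omega> in M. \<eta> (n + 1) \<omega> = e \<bar> \<forall>k\<in>{1..n}. \<eta> k \<omega> = h k) = pmf (erw_next_step p n h) e"
    and walk_0: "\<And>\<omega>. \<omega> \<in> space M \<Longrightarrow> X 0 \<omega> = 0"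
    and walk_Suc: "\<And>n \<omega>. \<omega> \<in> space M \<Longrightarrow> X (n + 1) \<omega> = X n \<omega> + \<eta> (n + 1) \<omega>"

definition transient :: "'a measure \<Rightarrow> (nat \<Rightarrow> 'a \<Rightarrow> int) \<Rightarrow> bool" where
  "transient M X \<longleftrightarrow> (AE \<omega> in M. filterlim (\<lambda>n. \<bar>X n \<omega>\<bar>) at_top sequentially)"

end

theory Submission imports Defs begin

text \<open>
  Put \<open>\<alpha> = 2 p - 1 > 1/2\<close>. Conditionally on any history up to time \<open>n\<close>, the moments satisfy
  \<open>u' = (1 + 2\<alpha>/m) u + 1\<close> for \<open>u = E X_m^2\<close> and
  \<open>v' = (1 + 4\<alpha>/m) v + (6 + 4\<alpha>/m) u + 1\<close> for \<open>v = E X_m^4\<close>. Hence \<open>v \<le> 3 u^2\<close> is preserved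
  and \<open>u / m\<close> grows at least like the harmonic series, so by a Paley-Zygmund argument
  \<open>X_N^2 \<ge> T N\<close> has conditional probability at least \<open>1/12\<close> once \<open>N\<close> is large, for every \<open>T\<close>.
  A walk that has reached \<open>X_N^2 \<ge> T N\<close> with \<open>T\<close> large avoids \<open>[-K, K]\<close> forever with probability
  at least \<open>1/2\<close>: with \<open>A_{m+1} = (1 + \<alpha>/m) A_m\<close>, the process
  \<open>(z - X_m / A_m)^2 + C m / A_m^2\<close> is a supermartingale for \<open>C = 1 / (2\<alpha> - 1)\<close>, and this is where
  \<open>p > 3/4\<close> enters. So the conditional probability of finitely many visits to \<open>[-K, K]\<close>
  is at least \<open>1/24\<close> whatever the history, which forces its probability to be 1.
\<close>

context elephant_random_walk
begin

section \<open>Events of the past, and the walk as a bounded measurable functional of the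
  steps\<close>

abbreviation "\<alpha> \<equiv> 2 * p - 1"

text \<open>The events of the sigma-algebra generated by \<open>\<eta> 1, \<dots>, \<eta> n\<close>.\<close>

definition past :: "nat \<Rightarrow> 'a set \<Rightarrow> bool" where
  "past n H \<longleftrightarrow> H \<in> events \<and>
     (\<forall>\<omega>\<in>space M. \<forall>\<omega>'\<in>space M. (\<forall>k\<in>{1..n}. \<eta> k \<omega> = \<eta> k \<omega>') \<longrightarrow> \<omega> \<in> H \<longrightarrow> \<omega>' \<in> H)"

lemma past_events: "past n H \<Longrightarrow> H \<in> events"
  by (simp add: past_def)

lemma past_mono: "past m H \<Longrightarrow> m \<le> n \<Longrightarrow> past n H"
  unfolding past_def by (smt (verit, best) atLeastAtMost_iff le_trans)

lemma past_Int: "past n H \<Longrightarrow> past n G \<Longrightarrow> past n (H \<inter> G)"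
  unfolding past_def by blast

lemma past_Un: "past n H \<Longrightarrow> past n G \<Longrightarrow> past n (H \<union> G)"
  unfolding past_def by blast

lemma past_Diff: "past n H \<Longrightarrow> past n G \<Longrightarrow> past n (H - G)"
  unfolding past_def by (metis DiffD1 DiffD2 DiffI sets.Diff)

lemma past_empty: "past n {}"
  unfolding past_def by simp

lemma past_UN:
  "finite I \<Longrightarrow> (\<And>i. i \<in> I \<Longrightarrow> past n (H i)) \<Longrightarrow> past n (\<Union>i\<in>I. H i)"
  by (induction I rule: finite_induct) (simp_all add: past_empty past_Un)

lemma walk_eq_sum: "\<omega> \<in> space M \<Longrightarrow> X n \<omega> = (\<Sum>k=1..n. \<eta> k \<omega>)"
proof (induction n)
  case (Suc n)
  then show ?case using walk_Suc[of \<omega> n] by simp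
qed (simp add: walk_0)

lemma walk_measurable [measurable]: "X n \<in> measurable M (count_space UNIV)"
proof -
  have "(\<lambda>\<omega>. \<Sum>k=1..m. \<eta> k \<omega>) \<in> measurable M (count_space UNIV)" for m
  proof (induction m)
    case (Suc m)
    have [measurable]: "\<eta> (Suc m) \<in> measurable M (count_space UNIV)"
      by (rule step_measurable) simp
    note Suc [measurable]
    have "(\<lambda>\<omega>. (\<Sum>k=1..m. \<eta> k \<omega>) + \<eta> (Suc m) \<omega>) \<in> measurable M (count_space UNIV)"
      by measurable
    then show ?case by simp
  qed simp
  then show ?thesis
    using measurable_cong[of M "X n" "\<lambda>\<omega>. \<Sum>k=1..n. \<eta> k \<omega>"] walk_eq_sum by blast
qed

lemma abs_walk_le: "\<omega> \<in> space M \<Longrightarrow> \<bar>X n \<omega>\<bar> \<le> int n"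
proof -
  assume w: "\<omega> \<in> space M"
  have "\<bar>\<Sum>k=1..n. \<eta> k \<omega>\<bar> \<le> (\<Sum>k=1..n. \<bar>\<eta> k \<omega>\<bar>)" by (rule sum_abs)
  also have "\<dots> \<le> (\<Sum>k=1..n. 1)"
    by (rule sum_mono) (use step_values[OF _ w] in force)
  finally show ?thesis using w by (simp add: walk_eq_sum)
qed

lemma past_walk: "m \<le> n \<Longrightarrow> past n {\<omega> \<in> space M. X m \<omega> \<in> B}"
  unfolding past_def
proof (intro conjI ballI impI)
  fix \<omega> \<omega>' assume a: "m \<le> n" "\<omega> \<in> space M" "\<omega>' \<in> space M" "\<forall>k\<in>{1..n}. \<eta> k \<omega> = \<eta> k \<omega>'"
    "\<omega> \<in> {\<omega> \<in> space M. X m \<omega> \<in> B}"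
  have "X m \<omega> = X m \<omega>'"
    using a by (simp add: walk_eq_sum)
  then show "\<omega>' \<in> {\<omega> \<in> space M. X m \<omega> \<in> B}" using a by simp
qed measurable

text \<open>At time \<open>n\<close> the walk takes finitely many values, those in
  \<open>{-int n..int n}\<close>, so every function of it is bounded. This settles all integrability
  questions below.\<close>

lemma integrable_walk:
  fixes f :: "int \<Rightarrow> real"
  assumes "H \<in> events"
  shows "integrable M (\<lambda>\<omega>. indicator H \<omega> * f (X n \<omega>))"
proof (rule integrable_const_bound)
  show "AE \<omega> in M. norm (indicator H \<omega> * f (X n \<omega>)) \<le> (\<Sum>x\<in>{-int n..int n}. \<bar>f x\<bar>)"
  proof (intro AE_I2)
    fix \<omega> assume w: "\<omega> \<in> space M"
    have "norm (indicator H \<omega> * f (X n \<omega>)) \<le> \<bar>f (X n \<omega>)\<bar>"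
      by (simp add: indicator_def)
    also have "\<dots> \<le> (\<Sum>x\<in>{-int n..int n}. \<bar>f x\<bar>)"
      by (rule member_le_sum) (use abs_walk_le[OF w, of n] in auto)
    finally show "norm (indicator H \<omega> * f (X n \<omega>)) \<le> (\<Sum>x\<in>{-int n..int n}. \<bar>f x\<bar>)" .
  qed
  show "(\<lambda>\<omega>. indicator H \<omega> * f (X n \<omega>)) \<in> borel_measurable M"
    using assms by measurable
qed

lemma integrable_indicator_event: "H \<in> events \<Longrightarrow> integrable M (indicator H :: 'a \<Rightarrow> real)"
  by (simp add: less_top[symmetric])

lemma integral_indicator_event: "H \<in> events \<Longrightarrow> expectation (indicator H) = prob H"
  by simp

section \<open>Averaging over one step, given the past\<close>

text \<open>These are the conditioning events in \<open>next_step\<close>, and the atoms of the past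
  of \<open>n\<close>.\<close>

definition cylinder :: "nat \<Rightarrow> (nat \<Rightarrow> int) \<Rightarrow> 'a set" where
  "cylinder n h = {\<omega> \<in> space M. \<forall>k\<in>{1..n}. \<eta> k \<omega> = h k}"

lemma cylinder_events: "cylinder n h \<in> events"
proof -
  have "{\<omega> \<in> space M. \<eta> k \<omega> = h k} \<in> events" if "k \<in> {1..n}" for k
  proof -
    have [measurable]: "\<eta> k \<in> measurable M (count_space UNIV)"
      by (rule step_measurable) (use that in simp)
    show ?thesis by measurable
  qed
  then show ?thesis unfolding cylinder_def by (intro sets.sets_Collect_finite_All) auto
qed

text \<open>Each point lies in exactly one cylinder, that of its own history \<open>g\<close>, and
  an event of the past contains a cylinder as soon as it contains one of its points. Extensional
  functions make the label \<open>h\<close> unique.\<close>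

lemma past_indicator_eq_sum:
  assumes "past n H" "\<omega> \<in> space M"
  shows "(indicator H \<omega> :: real) =
    (\<Sum>h | h \<in> ({1..n} \<rightarrow>\<^sub>E {-1,1}) \<and> cylinder n h \<subseteq> H. indicator (cylinder n h) \<omega>)"
    (is "_ = (\<Sum>h\<in>?S. _)")
proof -
  define g where "g = restrict (\<lambda>k. \<eta> k \<omega>) {1..n}"
  have fin: "finite ?S"
    by (rule finite_subset[of _ "{1..n} \<rightarrow>\<^sub>E {-1,1}"]) (auto intro!: finite_PiE)
  have g: "g \<in> {1..n} \<rightarrow>\<^sub>E {-1,1}"
    unfolding g_def using step_values[OF _ assms(2)] by auto
  have eq: "\<omega> \<in> cylinder n h \<longleftrightarrow> h = g" if "h \<in> {1..n} \<rightarrow>\<^sub>E {-1,1}" for h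
  proof
    assume "\<omega> \<in> cylinder n h"
    then have "h k = g k" if "k \<in> {1..n}" for k
      using that by (simp add: cylinder_def g_def)
    then show "h = g" using \<open>h \<in> _\<close> g by (meson PiE_ext)
  qed (use assms in \<open>simp add: cylinder_def g_def\<close>)
  have "cylinder n g \<subseteq> H \<longleftrightarrow> \<omega> \<in> H"
  proof
    assume "\<omega> \<in> H"
    then show "cylinder n g \<subseteq> H"
      using assms unfolding past_def cylinder_def g_def
      by (smt (verit, ccfv_threshold) mem_Collect_eq restrict_apply subsetI)
  qed (use eq[OF g] in auto)
  moreover have "(\<Sum>h\<in>?S. indicator (cylinder n h) \<omega>) = (\<Sum>h\<in>?S. if h = g then 1 else 0 :: real)"
    by (rule sum.cong) (use eq in \<open>auto simp: indicator_def\<close>)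
  ultimately show ?thesis
    using fin g by (simp add: indicator_def)
qed

context
  assumes p: "3 / 4 < p" "p \<le> 1"
begin

text \<open>The product form of the conditional law also covers cylinders of probability 0, where
  both sides vanish. The history enters only through its sum, the current position.\<close>

lemma prob_next_step:
  assumes n: "1 \<le> n" and h: "h \<in> {1..n} \<rightarrow>\<^sub>E {-1,1}" and e: "e \<in> {-1,1}"
  shows "prob (cylinder n h \<inter> {\<omega> \<in> space M. \<eta> (n + 1) \<omega> = e}) =
    prob (cylinder n h) * ((1 + \<alpha> * (of_int (\<Sum>k=1..n. h k) / n) * of_int e) / 2)"
proof (cases "prob (cylinder n h) > 0")
  case True
  have "pmf (erw_next_step p n h) e = 1 / (2 * real n) * (\<Sum>k=1..n. 1 + \<alpha> * real_of_int (h k * e))"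
    by (rule pmf_erw_next_step) (use p n h e in auto)
  also have "\<dots> = (1 + \<alpha> * (of_int (\<Sum>k=1..n. h k) / n) * of_int e) / 2"
  proof -
    have "(\<Sum>k=1..n. 1 + \<alpha> * real_of_int (h k * e)) = n + \<alpha> * (\<Sum>k=1..n. h k) * e"
      by (simp add: sum.distrib sum_distrib_left sum_distrib_right mult.assoc)
    then show ?thesis using n by (simp only:) (simp add: field_simps)
  qed
  finally have *: "pmf (erw_next_step p n h) e = \<dots>" .
  have "prob (cylinder n h \<inter> {\<omega> \<in> space M. \<eta> (n + 1) \<omega> = e}) / prob (cylinder n h)
      = pmf (erw_next_step p n h) e"
  proof -
    have "cylinder n h \<inter> {\<omega> \<in> space M. \<eta> (n + 1) \<omega> = e} =
        {\<omega> \<in> space M. \<eta> (n + 1) \<omega> = e \<and> (\<forall>k\<in>{1..n}. \<eta> k \<omega> = h k)}"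
      unfolding cylinder_def by blast
    then show ?thesis
      using next_step[OF n, of h e] True by (simp only: cond_prob_def cylinder_def)
  qed
  then show ?thesis using True * by (simp add: field_simps)
next
  case False
  have [measurable]: "\<eta> (n + 1) \<in> measurable M (count_space UNIV)"
    by (rule step_measurable) simp
  have "prob (cylinder n h \<inter> {\<omega> \<in> space M. \<eta> (n + 1) \<omega> = e}) \<le> prob (cylinder n h)"
    by (rule finite_measure_mono) (auto simp: cylinder_events)
  moreover have "prob (cylinder n h) = 0"
    using False by (simp add: zero_less_measure_iff)
  ultimately show ?thesis by (simp add: measure_le_0_iff)
qed

lemma step_expectation_cylinder:
  fixes f :: "int \<Rightarrow> real"
  assumes n: "1 \<le> n" and h: "h \<in> {1..n} \<rightarrow>\<^sub>E {-1,1}"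
  shows "expectation (\<lambda>\<omega>. indicator (cylinder n h) \<omega> * f (X (n + 1) \<omega>)) =
    expectation (\<lambda>\<omega>. indicator (cylinder n h) \<omega> *
      ((1 + \<alpha> * (X n \<omega> / n)) / 2 * f (X n \<omega> + 1) + (1 - \<alpha> * (X n \<omega> / n)) / 2 * f (X n \<omega> - 1)))"
proof -
  define s where "s = (\<Sum>k=1..n. h k)"
  let ?C = "cylinder n h" and ?E = "\<lambda>e. {\<omega> \<in> space M. \<eta> (n + 1) \<omega> = e}"
  have Xn: "X n \<omega> = s" if "\<omega> \<in> ?C" for \<omega>
    using that by (simp add: cylinder_def walk_eq_sum s_def)
  have [measurable]: "\<eta> (n + 1) \<in> measurable M (count_space UNIV)"
    by (rule step_measurable) simp
  note cylinder_events[measurable]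
  have "expectation (\<lambda>\<omega>. indicator ?C \<omega> * f (X (n + 1) \<omega>)) =
    expectation (\<lambda>\<omega>. f (s + 1) * indicator (?C \<inter> ?E 1) \<omega> + f (s - 1) * indicator (?C \<inter> ?E (-1)) \<omega>)"
  proof (rule Bochner_Integration.integral_cong[OF refl])
    fix \<omega> assume w: "\<omega> \<in> space M"
    have "\<eta> (n + 1) \<omega> = -1 \<or> \<eta> (n + 1) \<omega> = 1" using step_values[OF _ w, of "n + 1"] by auto
    then show "indicator ?C \<omega> * f (X (n + 1) \<omega>) =
      f (s + 1) * indicator (?C \<inter> ?E 1) \<omega> + f (s - 1) * indicator (?C \<inter> ?E (-1)) \<omega>"
      using w walk_Suc[OF w, of n] Xn[of \<omega>] by (auto simp: indicator_def)
  qed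
  also have "\<dots> = f (s + 1) * prob (?C \<inter> ?E 1) + f (s - 1) * prob (?C \<inter> ?E (-1))"
  proof -
    have "?C \<inter> ?E e \<in> events" for e by measurable
    note E = this[of 1] this[of "-1"]
    show ?thesis
      by (simp only: Bochner_Integration.integral_add integrable_mult_right
          E[THEN integrable_indicator_event] integral_mult_right_zero E[THEN integral_indicator_event])
  qed
  also have "\<dots> = ((1 + \<alpha> * (s / n)) / 2 * f (s + 1) + (1 - \<alpha> * (s / n)) / 2 * f (s - 1)) * prob ?C"
  proof -
    have e: "prob (?C \<inter> ?E 1) = prob ?C * ((1 + \<alpha> * (s / n)) / 2)"
      "prob (?C \<inter> ?E (-1)) = prob ?C * ((1 - \<alpha> * (s / n)) / 2)"
      using prob_next_step[OF n h, of 1] prob_next_step[OF n h, of "-1"] by (simp_all add: s_def)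
    show ?thesis unfolding e by (simp only: algebra_simps)
  qed
  also have "\<dots> = expectation (\<lambda>\<omega>.
     ((1 + \<alpha> * (s / n)) / 2 * f (s + 1) + (1 - \<alpha> * (s / n)) / 2 * f (s - 1)) * indicator ?C \<omega>)"
    using sets.sets_into_space[OF cylinder_events[of n h]] by (simp add: Int_absorb2)
  also have "\<dots> = expectation (\<lambda>\<omega>. indicator ?C \<omega> *
      ((1 + \<alpha> * (X n \<omega> / n)) / 2 * f (X n \<omega> + 1) + (1 - \<alpha> * (X n \<omega> / n)) / 2 * f (X n \<omega> - 1)))"
    by (rule Bochner_Integration.integral_cong[OF refl]) (use Xn in \<open>auto simp: indicator_def\<close>)
  finally show ?thesis .
qed

text \<open>Summing the cylinder identity over the cylinders inside \<open>H\<close> shows that,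
  given the past, the walk behaves like a time-inhomogeneous Markov chain. The moment recursions and
  the supermartingale inequality all come from this formula.\<close>

lemma step_expectation:
  fixes f :: "int \<Rightarrow> real"
  assumes n: "1 \<le> n" and H: "past n H"
  shows "expectation (\<lambda>\<omega>. indicator H \<omega> * f (X (n + 1) \<omega>)) =
    expectation (\<lambda>\<omega>. indicator H \<omega> *
      ((1 + \<alpha> * (X n \<omega> / n)) / 2 * f (X n \<omega> + 1) + (1 - \<alpha> * (X n \<omega> / n)) / 2 * f (X n \<omega> - 1)))"
proof -
  let ?S = "{h. h \<in> ({1..n} \<rightarrow>\<^sub>E {-1,1}) \<and> cylinder n h \<subseteq> H}"
  have *: "expectation (\<lambda>\<omega>. indicator H \<omega> * g (X m \<omega>)) =
      (\<Sum>h\<in>?S. expectation (\<lambda>\<omega>. indicator (cylinder n h) \<omega> * g (X m \<omega>)))"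
    for g :: "int \<Rightarrow> real" and m
  proof -
    have "expectation (\<lambda>\<omega>. indicator H \<omega> * g (X m \<omega>)) =
        expectation (\<lambda>\<omega>. \<Sum>h\<in>?S. indicator (cylinder n h) \<omega> * g (X m \<omega>))"
      by (rule Bochner_Integration.integral_cong[OF refl])
         (simp only: past_indicator_eq_sum[OF H] sum_distrib_right)
    then show ?thesis
      by (simp add: Bochner_Integration.integral_sum integrable_walk cylinder_events)
  qed
  show ?thesis
    unfolding *[of f]
      *[of "\<lambda>x. (1 + \<alpha> * (x / n)) / 2 * f (x + 1) + (1 - \<alpha> * (x / n)) / 2 * f (x - 1)"]
    by (rule sum.cong[OF refl]) (use step_expectation_cylinder[OF n] in simp)
qed


section \<open>Second and fourth moments, and the Paley-Zygmund bound\<close>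

abbreviation moment :: "nat \<Rightarrow> nat \<Rightarrow> 'a set \<Rightarrow> real" where
  "moment k n H \<equiv> expectation (\<lambda>\<omega>. indicator H \<omega> * real_of_int (X n \<omega>) ^ k)"

lemma integrable_moment:
  "H \<in> events \<Longrightarrow> integrable M (\<lambda>\<omega>. indicator H \<omega> * real_of_int (X n \<omega>) ^ k)"
  by (rule integrable_walk)

lemma moment_nonneg: "even k \<Longrightarrow> 0 \<le> moment k n H"
  by (rule Bochner_Integration.integral_nonneg) (auto simp: zero_le_even_power)

text \<open>From position \<open>x\<close> the next step has conditional mean \<open>a * x\<close>,
  with \<open>a = \<alpha> / m\<close>, and square 1. Hence the square of the position changes on
  average by \<open>2 * a * x\<^sup>2 + 1\<close>.\<close>

lemma second_moment_Suc:
  assumes m: "1 \<le> m" and H: "past m H"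
  shows "moment 2 (m + 1) H = (1 + 2 * (\<alpha> / m)) * moment 2 m H + prob H"
proof -
  note ev = past_events[OF H]
  have "moment 2 (m + 1) H = expectation (\<lambda>\<omega>.
      (1 + 2 * (\<alpha> / m)) * (indicator H \<omega> * real_of_int (X m \<omega>) ^ 2) + indicator H \<omega>)"
    unfolding step_expectation[OF m H, of "\<lambda>x. real_of_int x ^ 2"]
  proof (rule Bochner_Integration.integral_cong[OF refl])
    fix \<omega>
    define x where "x = real_of_int (X m \<omega>)"
    define a where "a = \<alpha> / m"
    have *: "\<alpha> * (x / m) = a * x" by (simp add: a_def)
    have "(1 + a * x) / 2 * (x + 1)\<^sup>2 + (1 - a * x) / 2 * (x - 1)\<^sup>2 = (1 + 2 * a) * x\<^sup>2 + 1"
      by (simp add: field_simps power2_eq_square)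
    then show "indicator H \<omega> * ((1 + \<alpha> * (real_of_int (X m \<omega>) / real m)) / 2 * (real_of_int (X m \<omega> + 1))\<^sup>2 +
           (1 - \<alpha> * (real_of_int (X m \<omega>) / real m)) / 2 * (real_of_int (X m \<omega> - 1))\<^sup>2) =
         (1 + 2 * (\<alpha> / m)) * (indicator H \<omega> * real_of_int (X m \<omega>) ^ 2) + indicator H \<omega>"
      unfolding of_int_add of_int_diff of_int_1 x_def[symmetric] a_def[symmetric] *
      by (cases "\<omega> \<in> H") simp_all
  qed
  also have "\<dots> = (1 + 2 * (\<alpha> / m)) * moment 2 m H + prob H"
    by (simp only: Bochner_Integration.integral_add integrable_mult_right integrable_moment[OF ev]
        integrable_indicator_event[OF ev] integral_mult_right_zero integral_indicator_event[OF ev])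
  finally show ?thesis .
qed

text \<open>In the binomial expansion, even powers of the step are 1 and odd powers have conditional
  mean \<open>a * x\<close>.\<close>

lemma fourth_moment_Suc:
  assumes m: "1 \<le> m" and H: "past m H"
  shows "moment 4 (m + 1) H =
    (1 + 4 * (\<alpha> / m)) * moment 4 m H + (6 + 4 * (\<alpha> / m)) * moment 2 m H + prob H"
proof -
  note ev = past_events[OF H]
  have "moment 4 (m + 1) H = expectation (\<lambda>\<omega>.
      (1 + 4 * (\<alpha> / m)) * (indicator H \<omega> * real_of_int (X m \<omega>) ^ 4) +
      (6 + 4 * (\<alpha> / m)) * (indicator H \<omega> * real_of_int (X m \<omega>) ^ 2) + indicator H \<omega>)"
    unfolding step_expectation[OF m H, of "\<lambda>x. real_of_int x ^ 4"]
  proof (rule Bochner_Integration.integral_cong[OF refl])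
    fix \<omega>
    define x where "x = real_of_int (X m \<omega>)"
    define a where "a = \<alpha> / m"
    have *: "\<alpha> * (x / m) = a * x" by (simp add: a_def)
    have "(1 + a * x) / 2 * (x + 1) ^ 4 + (1 - a * x) / 2 * (x - 1) ^ 4 =
        (1 + 4 * a) * x ^ 4 + (6 + 4 * a) * x\<^sup>2 + 1"
      by (simp add: field_simps power4_eq_xxxx power2_eq_square)
    then show "indicator H \<omega> * ((1 + \<alpha> * (real_of_int (X m \<omega>) / real m)) / 2 * (real_of_int (X m \<omega> + 1)) ^ 4 +
           (1 - \<alpha> * (real_of_int (X m \<omega>) / real m)) / 2 * (real_of_int (X m \<omega> - 1)) ^ 4) =
         (1 + 4 * (\<alpha> / m)) * (indicator H \<omega> * real_of_int (X m \<omega>) ^ 4) +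
      (6 + 4 * (\<alpha> / m)) * (indicator H \<omega> * real_of_int (X m \<omega>) ^ 2) + indicator H \<omega>"
      unfolding of_int_add of_int_diff of_int_1 x_def[symmetric] a_def[symmetric] *
      by (cases "\<omega> \<in> H") simp_all
  qed
  also have "\<dots> = (1 + 4 * (\<alpha> / m)) * moment 4 m H + (6 + 4 * (\<alpha> / m)) * moment 2 m H + prob H"
    by (simp only: Bochner_Integration.integral_add Bochner_Integration.integrable_add
        integrable_mult_right integrable_moment[OF ev]
        integrable_indicator_event[OF ev] integral_mult_right_zero integral_indicator_event[OF ev])
  finally show ?thesis .
qed

lemma moment_const:
  assumes "H \<in> events" "\<And>\<omega>. \<omega> \<in> H \<Longrightarrow> X n \<omega> = x"
  shows "moment k n H = real_of_int x ^ k * prob H"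
proof -
  have "moment k n H = expectation (\<lambda>\<omega>. real_of_int x ^ k * indicator H \<omega>)"
    by (rule Bochner_Integration.integral_cong[OF refl]) (use assms in \<open>auto simp: indicator_def\<close>)
  then show ?thesis
    by (simp only: integral_mult_right_zero integral_indicator_event[OF assms(1)])
qed

text \<open>Moments are not normalised by \<open>prob H\<close>, hence the extra factor on the left.
  Since the walk is constant on \<open>H\<close> at time \<open>n\<close>, the induction starts from
  \<open>moment 4 n H * prob H = (moment 2 n H)\<^sup>2\<close>. The constant 3 makes the cross term
  of the new square, at least \<open>6 * u * P\<close>, absorb the \<open>6 * u * P\<close> from the
  fourth-moment recursion.\<close>

lemma fourth_moment_le:
  assumes n: "1 \<le> n" "n \<le> m" and H: "past n H" and x: "\<And>\<omega>. \<omega> \<in> H \<Longrightarrow> X n \<omega> = x"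
  shows "moment 4 m H * prob H \<le> 3 * (moment 2 m H)\<^sup>2"
  using n(2)
proof (induction m rule: dec_induct)
  case base
  show ?case
  proof -
    have eq: "moment k n H = real_of_int x ^ k * prob H" for k
      by (rule moment_const[OF past_events[OF H] x])
    have "3 * (moment 2 n H)\<^sup>2 - moment 4 n H * prob H = 2 * (real_of_int x ^ 2 * prob H)\<^sup>2"
      unfolding eq by algebra
    then show ?thesis by (smt (verit) zero_le_power2)
  qed
next
  case (step m)
  define a u v P where "a = \<alpha> / m" and "u = moment 2 m H" and "v = moment 4 m H" and "P = prob H"
  have a: "0 \<le> a" using p by (simp add: a_def)
  have u: "0 \<le> u" unfolding u_def by (rule moment_nonneg) simp
  have P: "0 \<le> P" by (simp add: P_def)
  have m: "1 \<le> m" using n step by simp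
  have pm: "past m H" using past_mono[OF H] step by simp
  have "((1 + 4 * a) * v + (6 + 4 * a) * u + P) * P =
      (1 + 4 * a) * (v * P) + ((6 + 4 * a) * u + P) * P" by algebra
  also have "\<dots> \<le> (1 + 4 * a) * (3 * u\<^sup>2) + ((6 + 4 * a) * u + P) * P"
    using step.IH a by (intro add_right_mono mult_left_mono) (auto simp: u_def v_def P_def)
  also have "\<dots> = 3 * ((1 + 2 * a) * u + P)\<^sup>2 - (12 * (a * u)\<^sup>2 + 8 * (a * u * P) + 2 * P\<^sup>2)"
    by algebra
  also have "\<dots> \<le> 3 * ((1 + 2 * a) * u + P)\<^sup>2"
  proof -
    have "0 \<le> a * u * P" using a u P by simp
    then show ?thesis using zero_le_power2[of "a * u"] zero_le_power2[of P] by linarith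
  qed
  finally show ?case
    using second_moment_Suc[OF m pm] fourth_moment_Suc[OF m pm] by (simp add: a_def u_def v_def P_def)
qed

text \<open>As 2 \<alpha> \<ge> 1, the recursion gives \<open>u' \<ge> (1 + 1 / m) * u + P\<close>.
  Dividing by \<open>m + 1\<close>, the ratio of second moment to time grows by at least
  \<open>P / (m + 1)\<close> in each step.\<close>

lemma second_moment_ge:
  assumes n: "1 \<le> n" "n \<le> m" and H: "past n H"
  shows "real m * prob H * (harm m - harm n) \<le> moment 2 m H"
  using n(2)
proof (induction m rule: dec_induct)
  case base
  show ?case using moment_nonneg by simp
next
  case (step m)
  define a u P h where "a = \<alpha> / m" and "u = moment 2 m H" and "P = prob H"
    and "h = (harm m - harm n :: real)"
  have m: "1 \<le> m" using n step by simp
  have pm: "past m H" using past_mono[OF H] step by simp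
  have u: "0 \<le> u" unfolding u_def by (rule moment_nonneg) simp
  have a: "1 / m \<le> 2 * a" using p m by (simp add: a_def divide_simps)
  have "real (Suc m) * P * (harm (Suc m) - harm n) = (1 + 1 / m) * (real m * P * h) + P"
    using m by (simp add: harm_Suc h_def field_simps)
  also have "\<dots> \<le> (1 + 1 / m) * u + P"
    using step.IH m by (intro add_right_mono mult_left_mono) (auto simp: u_def P_def h_def)
  also have "\<dots> \<le> (1 + 2 * a) * u + P"
    using a u by (intro add_right_mono mult_right_mono) auto
  finally show ?case
    using second_moment_Suc[OF m pm] by (simp add: a_def u_def P_def)
qed

text \<open>Paley-Zygmund: the part of the second moment where the square is below
  \<open>T * m\<close> is at most \<open>T * m * prob H\<close>, which is at most half of the whole.
  The rest sits on \<open>?D\<close>, and the fourth-moment bound prevents it from sitting on too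
  small an event.\<close>

lemma prob_walk_large_ge:
  assumes n: "1 \<le> n" "n \<le> m" and H: "past n H" and x: "\<And>\<omega>. \<omega> \<in> H \<Longrightarrow> X n \<omega> = x"
    and T: "0 < T" "2 * T \<le> harm m - harm n"
  shows "prob H / 12 \<le> prob (H \<inter> {\<omega> \<in> space M. T * m \<le> real_of_int (X m \<omega>) ^ 2})"
    (is "_ \<le> prob ?D")
proof (cases "prob H = 0")
  case False
  define u v P where "u = moment 2 m H" and "v = moment 4 m H" and "P = prob H"
  have P: "0 < P" using False by (simp add: P_def zero_less_measure_iff)
  note ev = past_events[OF H]
  note ev [measurable]
  have D: "?D \<in> events" by measurable
  have "2 * (T * m * P) \<le> m * P * (harm m - harm n)"
    using mult_left_mono[OF T(2), of "m * P"] P by (simp add: algebra_simps)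
  also have "\<dots> \<le> u"
    using second_moment_ge[OF n H] by (simp add: u_def P_def)
  finally have u2: "2 * (T * m * P) \<le> u" .
  have "0 < T * m * P" using T P n by simp
  with u2 have u: "0 < u" by linarith
  \<comment> \<open>With this choice \<open>v / (2 * a) = v * P / (12 * u) \<le> u / 4\<close>. A
    quarter of \<open>u\<close> is then left for
    \<open>a / 2 * prob ?D = 3 * u / P * prob ?D\<close>, which gives the 1/12.\<close>
  define a where "a = 6 * u / P"
  have a: "0 < a" using u P by (simp add: a_def)
  have "u \<le> expectation (\<lambda>\<omega>. T * m * indicator H \<omega> + a / 2 * indicator ?D \<omega>
      + 1 / (2 * a) * (indicator H \<omega> * real_of_int (X m \<omega>) ^ 4))"
    unfolding u_def
  proof (rule integral_mono)
    fix \<omega> assume w: "\<omega> \<in> space M"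
    define y where "y = real_of_int (X m \<omega>) ^ 2"
    have y4: "real_of_int (X m \<omega>) ^ 4 = y\<^sup>2" by (simp add: y_def)
    \<comment> \<open>AM-GM replaces Cauchy-Schwarz on the event where the walk is large\<close>
    have "0 \<le> (y - a)\<^sup>2" by simp
    then have "y \<le> a / 2 + 1 / (2 * a) * y\<^sup>2"
      using a by (simp add: field_simps power2_eq_square)
    moreover have "0 \<le> T * m" "0 \<le> 1 / (2 * a) * y\<^sup>2" using T a by auto
    ultimately show "indicator H \<omega> * real_of_int (X m \<omega>) ^ 2 \<le>
      T * m * indicator H \<omega> + a / 2 * indicator ?D \<omega> + 1 / (2 * a) * (indicator H \<omega> * real_of_int (X m \<omega>) ^ 4)"
      unfolding y4 y_def[symmetric] using w by (auto simp: indicator_def y_def)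
  qed (intro Bochner_Integration.integrable_add integrable_mult_right integrable_moment ev D
      integrable_indicator_event)+
  also have "\<dots> = T * m * P + a / 2 * prob ?D + 1 / (2 * a) * v"
    unfolding P_def v_def
    by (simp only: Bochner_Integration.integral_add Bochner_Integration.integrable_add
        integrable_mult_right integrable_moment[OF ev] integrable_indicator_event[OF ev]
        integrable_indicator_event[OF D] integral_indicator_event[OF D]
        integral_mult_right_zero integral_indicator_event[OF ev])
  also have "\<dots> \<le> u / 2 + a / 2 * prob ?D + u / 4"
  proof -
    have "v * P \<le> 3 * u\<^sup>2"
      using fourth_moment_le[OF n H x] by (simp add: u_def v_def P_def)
    then have "1 / (2 * a) * v \<le> u / 4"
      using u P by (simp add: a_def field_simps power2_eq_square)
    then show ?thesis using u2 by linarith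
  qed
  finally have "u / 4 \<le> 3 * u / P * prob ?D" by (simp add: a_def)
  then have "P / 12 \<le> prob ?D" using u P by (simp add: field_simps)
  then show ?thesis by (simp add: P_def)
qed simp

section \<open>The quadratic supermartingale and escape from a far position\<close>

text \<open>This is \<open>A_m\<close> of the overview with \<open>A_1 = 1\<close>: the factor by
  which the conditional mean grows, so that \<open>X m / growth m\<close> is a martingale.\<close>

definition growth :: "nat \<Rightarrow> real" where
  "growth m = (\<Prod>k\<in>{1..<m}. 1 + \<alpha> / real k)"

lemma growth_Suc: "1 \<le> m \<Longrightarrow> growth (m + 1) = growth m * (1 + \<alpha> / m)"
  by (simp add: growth_def)

lemma growth_pos: "0 < growth m"
  unfolding growth_def by (rule prod_pos) (use p in \<open>auto intro!: add_pos_nonneg\<close>)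

lemma growth_mono:
  assumes "1 \<le> n" "n \<le> m"
  shows "growth n \<le> growth m"
  using assms(2)
proof (induction m rule: dec_induct)
  case (step m)
  have "growth m * 1 \<le> growth m * (1 + \<alpha> / m)"
    using p growth_pos[of m] by (intro mult_left_mono) auto
  with step assms growth_Suc[of m] show ?case by simp
qed simp

text \<open>This is \<open>C\<close> of the overview, chosen so that
  \<open>spread * (2 * \<alpha> - 1) = 1\<close> pays for the variance of one step, which is at most
  1.\<close>

definition spread :: real where
  "spread = 1 / (2 * \<alpha> - 1)"

lemma spread_ge_1: "1 \<le> spread"
  using p by (simp add: spread_def field_simps)

definition potential :: "real \<Rightarrow> nat \<Rightarrow> int \<Rightarrow> real" where
  "potential z m x = (z - x / growth m)\<^sup>2 + spread * m / (growth m)\<^sup>2"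

lemma potential_nonneg: "0 \<le> potential z m x"
  using spread_ge_1 by (simp add: potential_def)

text \<open>The martingale property keeps the mean of the scaled position at \<open>y / s\<close>,
  so averaging the square only adds the variance \<open>(1 - t\<^sup>2) / b\<^sup>2\<close>. The
  drop of the second summand of \<open>potential\<close> compensates for this, because
  \<open>spread * m * (1 + \<alpha> / m)\<^sup>2\<close> exceeds \<open>spread * (m + 1)\<close> by
  at least 1.\<close>

lemma potential_step:
  assumes m: "1 \<le> m"
  shows "(1 + \<alpha> * (real_of_int x / m)) / 2 * potential z (m + 1) (x + 1) +
    (1 - \<alpha> * (real_of_int x / m)) / 2 * potential z (m + 1) (x - 1) \<le> potential z m x"
proof -
  define b s y where "b = growth (m + 1)" and "s = growth m" and "y = real_of_int x"
  define t where "t = \<alpha> * (y / m)"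
  have b: "0 < b" and s: "0 < s" by (simp_all add: b_def s_def growth_pos)
  have bs: "b = s * (1 + \<alpha> / m)" using growth_Suc[OF m] by (simp add: b_def s_def)
  have ys: "y / s = (y + t) / b"
  proof -
    have "y + t = y * (1 + \<alpha> / m)" by (simp add: t_def distrib_left mult.commute)
    moreover have "1 + \<alpha> / m \<noteq> 0" using b bs by auto
    ultimately show ?thesis unfolding bs by simp
  qed
  have "(1 + t) / 2 * ((z - (y + 1) / b)\<^sup>2 + spread * (m + 1) / b\<^sup>2) +
      (1 - t) / 2 * ((z - (y - 1) / b)\<^sup>2 + spread * (m + 1) / b\<^sup>2) =
      (z - (y + t) / b)\<^sup>2 + (1 - t\<^sup>2 + spread * (m + 1)) / b\<^sup>2"
    using b by (simp add: field_simps power2_eq_square)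
  also have "\<dots> \<le> (z - y / s)\<^sup>2 + (spread * m * (1 + \<alpha> / m)\<^sup>2) / b\<^sup>2"
  proof -
    have "spread * m * (1 + \<alpha> / m)\<^sup>2 = spread * (m + 1) + spread * (2 * \<alpha> - 1) + spread * (\<alpha>\<^sup>2 / m)"
      using m by (simp add: field_simps power2_eq_square)
    moreover have "spread * (2 * \<alpha> - 1) = 1" using p by (simp add: spread_def)
    moreover have "0 \<le> spread * (\<alpha>\<^sup>2 / m)" using spread_ge_1 by simp
    ultimately have "1 - t\<^sup>2 + spread * (m + 1) \<le> spread * m * (1 + \<alpha> / m)\<^sup>2"
      using zero_le_power2[of t] by linarith
    then show ?thesis unfolding ys by (intro add_left_mono divide_right_mono) auto
  qed
  also have "(spread * m * (1 + \<alpha> / m)\<^sup>2) / b\<^sup>2 = spread * m / s\<^sup>2"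
  proof -
    have "1 + \<alpha> / m \<noteq> 0" using b bs by auto
    then show ?thesis unfolding bs by (simp add: power_mult_distrib)
  qed
  finally show ?thesis by (simp add: potential_def b_def s_def y_def t_def add.commute)
qed

lemma expectation_potential_Suc_le:
  assumes m: "1 \<le> m" and G: "past m G"
  shows "expectation (\<lambda>\<omega>. indicator G \<omega> * potential z (m + 1) (X (m + 1) \<omega>)) \<le>
    expectation (\<lambda>\<omega>. indicator G \<omega> * potential z m (X m \<omega>))"
  unfolding step_expectation[OF m G]
proof (rule integral_mono)
  show "integrable M (\<lambda>\<omega>. indicator G \<omega> *
    ((1 + \<alpha> * (real_of_int (X m \<omega>) / m)) / 2 * potential z (m + 1) (X m \<omega> + 1) +
     (1 - \<alpha> * (real_of_int (X m \<omega>) / m)) / 2 * potential z (m + 1) (X m \<omega> - 1)))"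
    using integrable_walk[OF past_events[OF G], of "\<lambda>x. (1 + \<alpha> * (real_of_int x / m)) / 2 * potential z (m + 1) (x + 1) +
     (1 - \<alpha> * (real_of_int x / m)) / 2 * potential z (m + 1) (x - 1)"] by simp
  show "integrable M (\<lambda>\<omega>. indicator G \<omega> * potential z m (X m \<omega>))"
    by (rule integrable_walk[OF past_events[OF G]])
qed (intro mult_left_mono potential_step m, simp)

text \<open>A maximal inequality for the supermartingale stopped at its first visit to
  \<open>{-K..K}\<close>. The induction bounds \<open>d\<^sup>2\<close> times the probability of
  having visited, plus the potential integrated over the paths that have not, by the initial
  potential.\<close>

lemma prob_visit_before_le:
  assumes N: "1 \<le> N" "N \<le> m" and H: "past N H" and x: "\<And>\<omega>. \<omega> \<in> H \<Longrightarrow> X N \<omega> = x"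
    and K: "K < \<bar>x\<bar>" "2 * spread * N \<le> (real_of_int (\<bar>x\<bar> - K))\<^sup>2"
  shows "prob (H \<inter> (\<Union>j\<in>{N..<m}. {\<omega> \<in> space M. X j \<omega> \<in> {-K..K}})) \<le> prob H / 2"
proof -
  \<comment> \<open>Centring at the starting value \<open>z\<close> leaves only the
    \<open>spread\<close> term of the potential at time \<open>N\<close>. Since
    \<open>growth\<close> is nondecreasing, \<open>d\<close> bounds from below the distance of
    \<open>z\<close> to the scaled position whenever the walk is in \<open>{-K..K}\<close> at a time
    from \<open>N\<close> on.\<close>
  define z d where "z = x / growth N" and "d = (\<bar>x\<bar> - K) / growth N"
  define V where "V m = H \<inter> (\<Union>j\<in>{N..<m}. {\<omega> \<in> space M. X j \<omega> \<in> {-K..K}})" for m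
  define Q where "Q m G = expectation (\<lambda>\<omega>. indicator G \<omega> * potential z m (X m \<omega>))" for m G
  have d: "0 < d" using K growth_pos by (simp add: d_def)
  \<comment> \<open>\<open>V m\<close> only looks at times below \<open>m\<close>, so
    \<open>V (Suc m)\<close> still belongs to the past of \<open>m\<close>. This allows the one-step
    inequality on its complement.\<close>
  have pastV: "past m' (V m)" if "N \<le> m'" "m \<le> m' + 1" for m m'
    unfolding V_def using that by (intro past_Int past_mono[OF H] past_UN past_walk) auto
  have "d\<^sup>2 * prob (V m) + Q m (H - V m) \<le> spread * N / (growth N)\<^sup>2 * prob H"
    using N(2)
  proof (induction m rule: dec_induct)
    case base
    have "Q N H = expectation (\<lambda>\<omega>. (spread * N / (growth N)\<^sup>2) * indicator H \<omega>)"
      unfolding Q_def by (rule Bochner_Integration.integral_cong[OF refl])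
        (use x in \<open>auto simp: indicator_def potential_def z_def\<close>)
    also have "\<dots> = spread * N / (growth N)\<^sup>2 * prob H"
      by (simp only: integral_mult_right_zero integral_indicator_event[OF past_events[OF H]])
    finally show ?case by (simp add: V_def)
  next
    case (step m)
    \<comment> \<open>The paths whose first visit from time \<open>N\<close> on is at
      \<open>m\<close>. Their potential, at least \<open>d\<^sup>2\<close> each, pays for the
      increase of \<open>prob (V m)\<close>.\<close>
    define W where "W = (H - V m) \<inter> {\<omega> \<in> space M. X m \<omega> \<in> {-K..K}}"
    have Hm: "past m H" using past_mono[OF H] step by simp
    have W: "past m W"
      unfolding W_def using step by (intro past_Int past_Diff Hm pastV past_walk) auto
    have V1: "V (Suc m) = V m \<union> W"
      using step by (auto simp: V_def W_def less_Suc_eq)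
    have G: "past m (H - V (Suc m))" using step by (intro past_Diff Hm pastV) auto
    have "prob (V (Suc m)) = prob (V m) + prob W"
      unfolding V1
    proof (rule finite_measure_Union)
      show "V m \<in> events" using step by (intro past_events[OF pastV[of m]]) auto
    qed (use past_events[OF W] in \<open>auto simp: W_def\<close>)
    moreover have "Q (Suc m) (H - V (Suc m)) \<le> Q m (H - V (Suc m))"
      using expectation_potential_Suc_le[OF _ G] N step by (simp add: Q_def)
    moreover have "Q m (H - V (Suc m)) + Q m W = Q m (H - V m)"
    proof -
      have "Q m (H - V m) = expectation (\<lambda>\<omega>. indicator (H - V (Suc m)) \<omega> * potential z m (X m \<omega>) +
          indicator W \<omega> * potential z m (X m \<omega>))"
        unfolding Q_def V1
        by (rule Bochner_Integration.integral_cong[OF refl]) (auto simp: indicator_def W_def)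
      then show ?thesis
        unfolding Q_def
        by (simp only: Bochner_Integration.integral_add integrable_walk past_events[OF G] past_events[OF W])
    qed
    moreover have "d\<^sup>2 * prob W \<le> Q m W"
    proof -
      have "d\<^sup>2 * prob W = expectation (\<lambda>\<omega>. d\<^sup>2 * indicator W \<omega>)"
        by (simp only: integral_mult_right_zero integral_indicator_event[OF past_events[OF W]])
      also have "\<dots> \<le> Q m W"
        unfolding Q_def
      proof (rule integral_mono)
        fix \<omega> assume "\<omega> \<in> space M"
        have "d\<^sup>2 \<le> potential z m (X m \<omega>)" if "\<omega> \<in> W"
        proof -
          define y where "y = X m \<omega>"
          have y: "\<bar>y\<bar> \<le> K" using that by (auto simp: W_def y_def)
          then have "\<bar>real_of_int y\<bar> \<le> real_of_int K" by linarith
          have "\<bar>real_of_int y / growth m\<bar> \<le> K / growth N"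
            unfolding abs_divide abs_of_pos[OF growth_pos]
            using y growth_pos[of N] growth_mono[of N m] N step
            by (intro frac_le) auto
          moreover have "\<bar>z\<bar> = \<bar>x\<bar> / growth N"
            using growth_pos[of N] by (simp add: z_def)
          moreover have "d = \<bar>x\<bar> / growth N - K / growth N"
            by (simp add: d_def diff_divide_distrib)
          ultimately have "d \<le> \<bar>z - y / growth m\<bar>" by linarith
          then have "d\<^sup>2 \<le> \<bar>z - y / growth m\<bar>\<^sup>2" using d by (intro power_mono) auto
          also have "\<dots> \<le> potential z m y"
            using spread_ge_1 by (simp add: potential_def)
          finally show ?thesis by (simp add: y_def)
        qed
        then show "d\<^sup>2 * indicator W \<omega> \<le> indicator W \<omega> * potential z m (X m \<omega>)"
          by (simp add: indicator_def)
      qed (intro integrable_mult_right integrable_indicator_event integrable_walk past_events[OF W])+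
      finally show ?thesis .
    qed
    ultimately show ?case using step.IH by (simp add: distrib_left)
  qed
  moreover have "0 \<le> Q m (H - V m)"
    unfolding Q_def by (intro Bochner_Integration.integral_nonneg) (simp add: potential_nonneg)
  ultimately have "d\<^sup>2 * prob (V m) \<le> spread * N / (growth N)\<^sup>2 * prob H" by linarith
  also have "\<dots> \<le> d\<^sup>2 / 2 * prob H"
  proof (rule mult_right_mono)
    \<comment> \<open>The distance hypothesis on \<open>x\<close> says that the initial potential is
      at most half of \<open>d\<^sup>2\<close>.\<close>
    have "2 * spread * N / (growth N)\<^sup>2 \<le> (real_of_int (\<bar>x\<bar> - K))\<^sup>2 / (growth N)\<^sup>2"
      by (rule divide_right_mono[OF K(2)]) simp
    then show "spread * N / (growth N)\<^sup>2 \<le> d\<^sup>2 / 2"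
      by (simp add: d_def power_divide)
  qed simp
  finally have "d\<^sup>2 * prob (V m) \<le> d\<^sup>2 * (prob H / 2)" by simp
  then have "prob (V m) \<le> prob H / 2" using d by (simp only: mult_le_cancel_left_pos zero_less_power)
  then show ?thesis by (simp add: V_def)
qed

section \<open>Infinitely many visits to a bounded window\<close>

text \<open>Decreasing in \<open>n\<close>; the intersection over all \<open>n\<close> is the event
  of infinitely many visits.\<close>

definition visits :: "int \<Rightarrow> nat \<Rightarrow> 'a set" where
  "visits K n = {\<omega> \<in> space M. \<exists>m\<ge>n. X m \<omega> \<in> {-K..K}}"

lemma visits_events [measurable]: "visits K n \<in> events"
proof -
  have "visits K n = (\<Union>m\<in>{n..}. {\<omega> \<in> space M. X m \<omega> \<in> {-K..K}})"
    by (auto simp: visits_def)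
  also have "\<dots> \<in> events"
    using past_events[OF past_walk[OF order_refl]] by (intro sets.countable_UN') auto
  finally show ?thesis .
qed

lemma infinitely_often_events: "(\<Inter>i. visits K i) \<in> events"
  by measurable

text \<open>Continuity from below carries the estimates on finite windows over to all later
  times.\<close>

lemma window_tendsto_visits:
  assumes "H \<in> events"
  shows "(\<lambda>m. prob (H \<inter> (\<Union>j\<in>{n..<m}. {\<omega> \<in> space M. X j \<omega> \<in> {-K..K}})))
    \<longlonglongrightarrow> prob (H \<inter> visits K n)"
proof -
  have "(\<Union>m. H \<inter> (\<Union>j\<in>{n..<m}. {\<omega> \<in> space M. X j \<omega> \<in> {-K..K}})) = H \<inter> visits K n"
  proof (intro equalityI subsetI)
    fix \<omega> assume "\<omega> \<in> H \<inter> visits K n"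
    then obtain j where "\<omega> \<in> H" "\<omega> \<in> space M" "n \<le> j" "X j \<omega> \<in> {-K..K}"
      by (auto simp: visits_def)
    then show "\<omega> \<in> (\<Union>m. H \<inter> (\<Union>j\<in>{n..<m}. {\<omega> \<in> space M. X j \<omega> \<in> {-K..K}}))"
      by (intro UN_I[of "Suc j"] IntI UN_I[of j]) auto
  qed (auto simp: visits_def)
  moreover have "(\<lambda>m. prob (H \<inter> (\<Union>j\<in>{n..<m}. {\<omega> \<in> space M. X j \<omega> \<in> {-K..K}})))
    \<longlonglongrightarrow> prob (\<Union>m. H \<inter> (\<Union>j\<in>{n..<m}. {\<omega> \<in> space M. X j \<omega> \<in> {-K..K}}))"
  proof (rule finite_Lim_measure_incseq)
    show "incseq (\<lambda>m. H \<inter> (\<Union>j\<in>{n..<m}. {\<omega> \<in> space M. X j \<omega> \<in> {-K..K}}))"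
      by (intro monoI Int_mono UN_mono) auto
  qed (use assms in auto)
  ultimately show ?thesis by (simp only:)
qed

lemma prob_visits_le:
  assumes N: "1 \<le> N" and H: "past N H" and x: "\<And>\<omega>. \<omega> \<in> H \<Longrightarrow> X N \<omega> = x"
    and K: "K < \<bar>x\<bar>" "2 * spread * N \<le> (real_of_int (\<bar>x\<bar> - K))\<^sup>2"
  shows "prob (H \<inter> visits K N) \<le> prob H / 2"
  using prob_visit_before_le[OF N _ H x K]
  by (intro LIMSEQ_le_const2[OF window_tendsto_visits[OF past_events[OF H]]] exI allI impI)

text \<open>Splitting by the position at time \<open>n\<close> lets estimates for a known position
  be summed.\<close>

lemma prob_eq_sum_walk:
  assumes [measurable]: "H \<in> events"
  shows "prob H = (\<Sum>y\<in>{-int n..int n}. prob (H \<inter> {\<omega> \<in> space M. X n \<omega> \<in> {y}}))"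
proof -
  have "H = (\<Union>y\<in>{-int n..int n}. H \<inter> {\<omega> \<in> space M. X n \<omega> \<in> {y}})"
  proof (intro equalityI subsetI)
    fix \<omega> assume "\<omega> \<in> H"
    moreover from this have "\<omega> \<in> space M" using assms sets.sets_into_space by blast
    ultimately show "\<omega> \<in> (\<Union>y\<in>{-int n..int n}. H \<inter> {\<omega> \<in> space M. X n \<omega> \<in> {y}})"
      using abs_walk_le[of \<omega> n] by auto
  qed auto
  then have "prob H = prob (\<Union>y\<in>{-int n..int n}. H \<inter> {\<omega> \<in> space M. X n \<omega> \<in> {y}})"
    by (rule arg_cong[where f = prob])
  also have "\<dots> = (\<Sum>y\<in>{-int n..int n}. prob (H \<inter> {\<omega> \<in> space M. X n \<omega> \<in> {y}}))"
    by (rule finite_measure_finite_Union) (auto simp: disjoint_family_on_def)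
  finally show ?thesis .
qed

text \<open>The factor 8 serves twice: it forces \<open>2 * K < \<bar>y\<bar>\<close>, so that
  \<open>\<bar>y\<bar> - K\<close> is at least half of \<open>\<bar>y\<bar>\<close>, and the square
  of that half is still at least \<open>2 * spread * N\<close>.\<close>

lemma prob_visits_from_large_le:
  assumes N: "1 \<le> N" and H: "past N H" and K: "0 \<le> K" "real_of_int K ^ 2 \<le> N"
    and large: "\<And>\<omega>. \<omega> \<in> H \<Longrightarrow> 8 * spread * N \<le> real_of_int (X N \<omega>) ^ 2"
  shows "prob (H \<inter> visits K N) \<le> prob H / 2"
proof -
  have "prob (H \<inter> visits K N) =
      (\<Sum>y\<in>{-int N..int N}. prob (H \<inter> visits K N \<inter> {\<omega> \<in> space M. X N \<omega> \<in> {y}}))"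
    by (intro prob_eq_sum_walk sets.Int past_events[OF H] visits_events)
  also have "\<dots> \<le> (\<Sum>y\<in>{-int N..int N}. prob (H \<inter> {\<omega> \<in> space M. X N \<omega> \<in> {y}}) / 2)"
  proof (rule sum_mono)
    fix y
    let ?H = "H \<inter> {\<omega> \<in> space M. X N \<omega> \<in> {y}}"
    have eq: "H \<inter> visits K N \<inter> {\<omega> \<in> space M. X N \<omega> \<in> {y}} = ?H \<inter> visits K N" by blast
    show "prob (H \<inter> visits K N \<inter> {\<omega> \<in> space M. X N \<omega> \<in> {y}}) \<le> prob ?H / 2"
    proof (cases "?H = {}")
      case False
      then have y: "8 * spread * N \<le> real_of_int \<bar>y\<bar> ^ 2" using large by force
      have "(2 * real_of_int K)\<^sup>2 < 8 * spread * N"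
      proof -
        have "8 * real N \<le> 8 * spread * N"
          using mult_right_mono[OF spread_ge_1, of "8 * real N"] by simp
        moreover have "(2 * real_of_int K)\<^sup>2 \<le> 4 * real N"
          using K by (simp add: power_mult_distrib)
        moreover have "0 < real N" using N by simp
        ultimately show ?thesis by linarith
      qed
      with y have "(2 * real_of_int K)\<^sup>2 < real_of_int \<bar>y\<bar> ^ 2" by linarith
      then have Ky: "2 * real_of_int K < real_of_int \<bar>y\<bar>" by (rule power_less_imp_less_base) simp
      have "2 * spread * N \<le> (real_of_int \<bar>y\<bar> / 2) ^ 2"
        using y by (simp add: power_divide)
      also have "\<dots> \<le> (real_of_int (\<bar>y\<bar> - K))\<^sup>2"
        using Ky by (intro power_mono) auto
      finally have *: "2 * spread * N \<le> (real_of_int (\<bar>y\<bar> - K))\<^sup>2" .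
      have "K < \<bar>y\<bar>" using Ky K by linarith
      then show ?thesis
        unfolding eq
        by (intro prob_visits_le[OF N past_Int[OF H past_walk[OF order_refl]] _ _ *]) simp_all
    qed (unfold eq, simp)
  qed
  also have "\<dots> = prob H / 2"
    using prob_eq_sum_walk[OF past_events[OF H], of N] by (simp add: sum_divide_distrib)
  finally show ?thesis .
qed

text \<open>With probability at least 1/12 of that of \<open>H\<close> the walk is far out at a
  suitable later time \<open>N\<close>, and at least half of those paths never return to the window:
  1/24 in total.\<close>

lemma prob_not_infinitely_often_ge_point:
  assumes n: "1 \<le> n" and H: "past n H" and x: "\<And>\<omega>. \<omega> \<in> H \<Longrightarrow> X n \<omega> = x" and K: "0 \<le> K"
  shows "prob H / 24 \<le> prob (H - (\<Inter>i. visits K i))"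
proof -
  \<comment> \<open>The 16 is twice the 8 in \<open>T = 8 * spread\<close>, as
    \<open>prob_walk_large_ge\<close> asks for \<open>2 * T\<close>.\<close>
  have "eventually (\<lambda>N. 16 * spread + harm n \<le> harm N) sequentially"
    using harm_at_top by (auto simp: filterlim_at_top)
  moreover have "eventually (\<lambda>N. real_of_int K ^ 2 \<le> real N) sequentially"
    using filterlim_real_sequentially by (auto simp: filterlim_at_top)
  moreover note eventually_ge_at_top[of n]
  ultimately have "eventually (\<lambda>N. 16 * spread + harm n \<le> harm N \<and> real_of_int K ^ 2 \<le> real N \<and> n \<le> N) sequentially"
    by (intro eventually_conj)
  then obtain N where N: "16 * spread + harm n \<le> harm N" "real_of_int K ^ 2 \<le> real N" "n \<le> N"
    using eventually_happens'[OF sequentially_bot] by blast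
  let ?D = "H \<inter> {\<omega> \<in> space M. 8 * spread * N \<le> real_of_int (X N \<omega>) ^ 2}"
  have D: "past N ?D"
    using past_Int[OF past_mono[OF H N(3)] past_walk[of N N "{y. 8 * spread * N \<le> real_of_int y ^ 2}"]]
    by simp
  have "prob H / 12 \<le> prob ?D"
    by (rule prob_walk_large_ge[OF n N(3) H x]) (use N spread_ge_1 in auto)
  moreover have "prob (?D \<inter> visits K N) \<le> prob ?D / 2"
    by (rule prob_visits_from_large_le[OF _ D K N(2)]) (use n N in auto)
  moreover have "prob (?D - visits K N) = prob ?D - prob (?D \<inter> visits K N)"
    by (rule finite_measure_Diff') (use past_events[OF D] in auto)
  moreover have "prob (?D - visits K N) \<le> prob (H - (\<Inter>i. visits K i))"
    by (rule finite_measure_mono) (blast, intro sets.Diff past_events[OF H] infinitely_often_events)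
  ultimately show ?thesis by linarith
qed

lemma prob_not_infinitely_often_ge:
  assumes n: "1 \<le> n" and H: "past n H" and K: "0 \<le> K"
  shows "prob H / 24 \<le> prob (H - (\<Inter>i. visits K i))"
proof -
  let ?E = "\<lambda>y. {\<omega> \<in> space M. X n \<omega> \<in> {y}}"
  have "prob H / 24 = (\<Sum>y\<in>{-int n..int n}. prob (H \<inter> ?E y) / 24)"
    using prob_eq_sum_walk[OF past_events[OF H], of n] by (simp add: sum_divide_distrib)
  also have "\<dots> \<le> (\<Sum>y\<in>{-int n..int n}. prob ((H - (\<Inter>i. visits K i)) \<inter> ?E y))"
  proof (rule sum_mono)
    fix y
    have "(H - (\<Inter>i. visits K i)) \<inter> ?E y = (H \<inter> ?E y) - (\<Inter>i. visits K i)" by blast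
    moreover have "prob (H \<inter> ?E y) / 24 \<le> prob ((H \<inter> ?E y) - (\<Inter>i. visits K i))"
      by (rule prob_not_infinitely_often_ge_point[OF n past_Int[OF H past_walk[OF order_refl]] _ K, of _ y])
         simp
    ultimately show "prob (H \<inter> ?E y) / 24 \<le> prob ((H - (\<Inter>i. visits K i)) \<inter> ?E y)" by simp
  qed
  also have "\<dots> = prob (H - (\<Inter>i. visits K i))"
    by (intro prob_eq_sum_walk[symmetric] sets.Diff past_events[OF H] infinitely_often_events)
  finally show ?thesis .
qed

text \<open>
  Infinitely many visits is approximated by the finite-window event \<open>W m\<close>, which belongs to the
  past of \<open>m\<close>; a \<open>1/24\<close> fraction of \<open>W m\<close> must then lie in the small set \<open>visits K n\<close> minus the limit.
\<close>

lemma prob_infinitely_often: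
  assumes K: "0 \<le> K"
  shows "prob (\<Inter>i. visits K i) = 0"
proof (rule ccontr)
  let ?I = "\<Inter>i. visits K i"
  define q where "q = prob ?I"
  assume "prob ?I \<noteq> 0"
  then have q: "0 < q" by (simp add: q_def zero_less_measure_iff)
  have "(\<lambda>n. prob (visits K n)) \<longlonglongrightarrow> q"
    unfolding q_def
    by (rule finite_Lim_measure_decseq)
       (auto simp: decseq_def visits_events, auto simp: visits_def intro: order_trans)
  \<comment> \<open>The margin \<open>q / 25\<close> closes the argument:
    \<open>prob (W m) > 24 * q / 25\<close> makes the 1/24 fraction exceed \<open>q / 25\<close>,
    while \<open>visits K n\<close> has less than \<open>q / 25\<close> outside the limit.\<close>
  then have "eventually (\<lambda>n. prob (visits K n) < q + q / 25) sequentially"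
    by (rule order_tendstoD(2)) (use q in simp)
  then have "eventually (\<lambda>n. prob (visits K n) < q + q / 25 \<and> 1 \<le> n) sequentially"
    using eventually_ge_at_top[of 1] by (rule eventually_conj)
  then obtain n where n: "prob (visits K n) < q + q / 25" "1 \<le> n"
    using eventually_happens'[OF sequentially_bot] by blast
  define W where "W m = space M \<inter> (\<Union>j\<in>{n..<m}. {\<omega> \<in> space M. X j \<omega> \<in> {-K..K}})" for m
  have "(\<lambda>m. prob (W m)) \<longlonglongrightarrow> prob (space M \<inter> visits K n)"
    unfolding W_def by (rule window_tendsto_visits) simp
  moreover have "space M \<inter> visits K n = visits K n" by (auto simp: visits_def)
  moreover have "q \<le> prob (visits K n)"
    unfolding q_def by (rule finite_measure_mono) auto
  ultimately have "eventually (\<lambda>m. q - q / 25 < prob (W m)) sequentially"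
    using q by (intro order_tendstoD(1)[of _ "prob (visits K n)"]) auto
  then have "eventually (\<lambda>m. q - q / 25 < prob (W m) \<and> 1 \<le> m) sequentially"
    using eventually_ge_at_top[of 1] by (rule eventually_conj)
  then obtain m where m: "q - q / 25 < prob (W m)" "1 \<le> m"
    using eventually_happens'[OF sequentially_bot] by blast
  have "past m (W m)"
    unfolding W_def by (intro past_Int past_UN past_walk) (auto simp: past_def)
  then have "prob (W m) / 24 \<le> prob (W m - ?I)"
    by (rule prob_not_infinitely_often_ge[OF m(2) _ K])
  also have "\<dots> \<le> prob (visits K n - ?I)"
    by (rule finite_measure_mono) (auto simp: W_def visits_def)
  also have "\<dots> = prob (visits K n) - q"
    unfolding q_def by (rule finite_measure_Diff) (auto simp: infinitely_often_events)
  finally show False using n m by simp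
qed

section \<open>From null events for each window to transience\<close>

lemma transient_walk: "transient M X"
proof -
  have "AE \<omega> in M. \<forall>K. \<omega> \<notin> (\<Inter>i. visits (int K) i)"
    unfolding AE_all_countable
  proof
    fix K
    have "(\<Inter>i. visits (int K) i) \<in> null_sets M"
      using prob_infinitely_often[of "int K"] by (intro null_setsI) (auto simp: emeasure_eq_measure)
    then show "AE \<omega> in M. \<omega> \<notin> (\<Inter>i. visits (int K) i)" by (rule AE_not_in)
  qed
  then show ?thesis
    unfolding transient_def
  proof (rule AE_mp, intro AE_I2 impI)
    fix \<omega> assume w: "\<omega> \<in> space M" and a: "\<forall>K. \<omega> \<notin> (\<Inter>i. visits (int K) i)"
    show "filterlim (\<lambda>n. \<bar>X n \<omega>\<bar>) at_top sequentially"
      unfolding filterlim_at_top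
    proof
      fix Z :: int
      \<comment> \<open>Passing through \<open>nat Z\<close> treats a negative threshold as 0, for
        which the bound is trivial.\<close>
      obtain i where "\<omega> \<notin> visits (int (nat Z)) i" using a by blast
      then have out: "X m \<omega> \<notin> {-int (nat Z)..int (nat Z)}" if "i \<le> m" for m
        using that w by (simp add: visits_def)
      have "Z \<le> \<bar>X m \<omega>\<bar>" if "i \<le> m" for m
        using out[OF that] by (cases "0 \<le> Z") auto
      then show "eventually (\<lambda>n. Z \<le> \<bar>X n \<omega>\<bar>) sequentially"
        unfolding eventually_sequentially by blast
    qed
  qed
qed

end

end

theorem theorem3p3:
  fixes M :: "'a measure" and p r :: real
    and \<eta> :: "nat \<Rightarrow> 'a \<Rightarrow> int" and X :: "nat \<Rightarrow> 'a \<Rightarrow> int"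
  assumes "0 \<le> p" "p \<le> 1" "0 \<le> r" "r \<le> 1"
    and "elephant_random_walk M p r \<eta> X"
    and "p > 3 / 4"
  shows "transient M X"
  using assms elephant_random_walk.transient_walk by blast

end
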